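(* Let $\mathbb{K}$ be a field, let $m\ge 5$ be an integer, and let $I=\langle u_1,\ldots,u_m\rangle\subset\mathbb{K}[x,y]$ be an ideal with $u_i=x^{a_i}y^{b_i}$ for all $i\in\{1,\ldots,m\}$, where $a_i,b_i$ are non-negative integers with $a_1>a_2>\cdots>a_m$ and $b_1<b_2<\cdots<b_m$. Assume that the following five divisibility conditions hold: \begin{itemize} \item $u_1u_m \mid u_2u_{m-1}$; \item $u_2^2 \mid u_1u_3$; \item $u_{m-1}^2 \mid u_{m-2}u_m$; \item $u_2^2 \mid u_1u_{m-2}$; \item $u_{m-1}^2 \mid u_3u_m$. \end{itemize} Then $$G(I^2)=\{u_1^2,\;u_1u_2,\;u_2^2\}\cup\{u_1u_{m-1},\;u_1u_m,\;u_2u_m\}\cup\{u_{m-1}^2,\;u_{m-1}u_m,\;u_m^2\}.$$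
   Context: For a monomial ideal $I\subset\mathbb{K}[x,y]$, $G(I)$ denotes the unique minimal monomial generating set of $I$. $u\mid v$ denotes divisibility of monomials in $\mathbb{K}[x,y]$, and $I^2$ is the square of the ideal $I$. *)

theory Defs
  imports Complex_Main "HOL-Library.Poly_Mapping" "HOL-Library.Product_Plus"
begin

text \<open>The polynomial ring in two variables over \<open>'k\<close> is taken as the monoid algebra of
  \<open>\<nat> \<times> \<nat>\<close>: finitely supported coefficient functions on exponent pairs, multiplied by convolution.\<close>

type_synonym 'k poly2 = "(nat \<times> nat) \<Rightarrow>\<^sub>0 'k"

definition var_x :: "'k::comm_ring_1 poly2"
  where "var_x = Poly_Mapping.single (1, 0) 1"

definition var_y :: "'k::comm_ring_1 poly2"
  where "var_y = Poly_Mapping.single (0, 1) 1"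

definition monomials :: "'k::comm_ring_1 poly2 set"
  where "monomials = {var_x ^ a * var_y ^ b | a b. True}"

lemma var_x_power: "var_x ^ a = Poly_Mapping.single (a, 0) (1 :: 'k::comm_ring_1)"
  by (induction a) (simp_all add: var_x_def mult_single zero_prod_def flip: single_one)

lemma var_y_power: "var_y ^ b = Poly_Mapping.single (0, b) (1 :: 'k::comm_ring_1)"
  by (induction b) (simp_all add: var_y_def mult_single zero_prod_def flip: single_one)

lemma monomial_eq_single:
  "var_x ^ a * var_y ^ b = Poly_Mapping.single (a, b) (1 :: 'k::comm_ring_1)"
  by (simp add: var_x_power var_y_power mult_single)

text \<open>Ideals of a commutative ring are its submodules as a module over itself.\<close>

global_interpretation ring_module: module "(*) :: 'a::comm_ring_1 \<Rightarrow> 'a \<Rightarrow> 'a"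
  by standard (simp_all add: algebra_simps)

definition ideal_gen :: "'a::comm_ring_1 set \<Rightarrow> 'a set"
  where "ideal_gen S = ring_module.span S"

definition ideal_square :: "'a::comm_ring_1 set \<Rightarrow> 'a set"
  where "ideal_square I = ideal_gen {f * g | f g. f \<in> I \<and> g \<in> I}"

definition is_min_monomial_gens :: "'k::comm_ring_1 poly2 set \<Rightarrow> 'k poly2 set \<Rightarrow> bool"
  where "is_min_monomial_gens I G \<longleftrightarrow>
    G \<subseteq> monomials \<and> ideal_gen G = I \<and> (\<forall>H. H \<subset> G \<longrightarrow> ideal_gen H \<noteq> I)"

text \<open>The description below determines a set only if \<open>I\<close> is a monomial ideal.\<close>

definition min_monomial_gens :: "'k::comm_ring_1 poly2 set \<Rightarrow> 'k poly2 set"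
  where "min_monomial_gens I = (THE G. is_min_monomial_gens I G)"

end

theory Submission
  imports Defs "HOL-Library.Product_Order"
begin

text \<open>Passing to exponents, a monomial ideal with an antichain \<open>A\<close> of generators has \<open>A\<close> as its
  unique minimal generating set, so it suffices to study the sums \<open>e i + e j\<close> with
  \<open>e i = (a i, b i)\<close>. The hypotheses say
  \<open>a 2 - a (m - 2) \<le> a 1 - a 2 \<le> a (m - 1) - a m \<le> a (m - 2) - a (m - 1)\<close> and symmetrically for \<open>b\<close>:
  the middle exponents are clustered more tightly than the outer gaps. Hence for
  \<open>3 \<le> i \<le> m - 2\<close> the product \<open>u i * u j\<close> is a multiple of \<open>(u 2)\<^sup>2\<close>, \<open>u 1 * u (m - 1)\<close>, \<open>u 1 * u m\<close>,
  \<open>u 2 * u m\<close> or \<open>(u (m - 1))\<^sup>2\<close> according as \<open>j\<close> is \<open>1\<close>, \<open>2\<close>, in the middle, \<open>m - 1\<close> or \<open>m\<close>.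
  The only other product to cover, \<open>u 2 * u (m - 1)\<close>, is a multiple of \<open>u 1 * u m\<close> by hypothesis.
  In the order listed, the nine generators have strictly decreasing \<open>x\<close>-exponents and strictly
  increasing \<open>y\<close>-exponents.\<close>

abbreviation mon :: "nat \<times> nat \<Rightarrow> 'k::comm_ring_1 poly2"
  where "mon p \<equiv> Poly_Mapping.single p 1"

lemma mon_mult: "mon p * mon q = mon (p + q)"
  by (simp add: mult_single)

lemma monomials_eq: "monomials = range mon"
  by (auto simp: monomials_def monomial_eq_single)

text \<open>The polynomials all of whose exponents lie above points of \<open>A\<close> form an
  ideal, since each exponent of \<open>c * f\<close> is at least some exponent of \<open>f\<close>.
  This ideal contains the generators.\<close>

lemma keys_ideal_gen_monomials:
  assumes "f \<in> ideal_gen (mon ` A)" "p \<in> Poly_Mapping.keys f"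
  shows "\<exists>s\<in>A. s \<le> p"
proof -
  have "\<forall>p\<in>Poly_Mapping.keys f. \<exists>s\<in>A. s \<le> p"
    using assms(1) unfolding ideal_gen_def
  proof (rule ring_module.span_induct)
    show "ring_module.subspace {f :: 'a poly2. \<forall>p\<in>Poly_Mapping.keys f. \<exists>s\<in>A. s \<le> p}"
    proof (rule ring_module.subspaceI)
      fix c f :: "'a poly2"
      assume f: "f \<in> {f. \<forall>p\<in>Poly_Mapping.keys f. \<exists>s\<in>A. s \<le> p}"
      have "\<exists>s\<in>A. s \<le> p" if p: "p \<in> Poly_Mapping.keys (c * f)" for p
      proof -
        obtain q r where "p = q + r" "r \<in> Poly_Mapping.keys f"
          using p keys_mult[of c f] by blast
        moreover from this obtain s where "s \<in> A" "s \<le> r"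
          using f by auto
        ultimately show ?thesis
          by (intro bexI[of _ s]) (auto simp: less_eq_prod_def)
      qed
      then show "c * f \<in> {f. \<forall>p\<in>Poly_Mapping.keys f. \<exists>s\<in>A. s \<le> p}"
        by blast
    next
      fix f g :: "'a poly2"
      assume "f \<in> {f. \<forall>p\<in>Poly_Mapping.keys f. \<exists>s\<in>A. s \<le> p}" "g \<in> {f. \<forall>p\<in>Poly_Mapping.keys f. \<exists>s\<in>A. s \<le> p}"
      then show "f + g \<in> {f. \<forall>p\<in>Poly_Mapping.keys f. \<exists>s\<in>A. s \<le> p}"
        using keys_add[of f g] by blast
    qed simp
  qed auto
  then show ?thesis
    using assms(2) by blast
qed

lemma mon_dvd_iff: "(mon p :: 'k::comm_ring_1 poly2) dvd mon q \<longleftrightarrow> p \<le> q"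
proof
  assume "(mon p :: 'k poly2) dvd mon q"
  then obtain k where k: "(mon q :: 'k poly2) = k * mon p"
    by (metis dvdE mult.commute)
  have "(mon q :: 'k poly2) \<in> ideal_gen (mon ` {p})"
    unfolding ideal_gen_def k by (intro ring_module.span_scale ring_module.span_base) simp
  then show "p \<le> q"
    using keys_ideal_gen_monomials[of "mon q :: 'k poly2" "{p}" q] by simp
next
  assume "p \<le> q"
  then have "mon q = mon p * (mon (fst q - fst p, snd q - snd p) :: 'k poly2)"
    by (cases p, cases q) (simp add: mon_mult)
  then show "(mon p :: 'k poly2) dvd mon q"
    by (rule dvdI)
qed

lemma mon_in_ideal_gen_iff:
  "(mon p :: 'k::comm_ring_1 poly2) \<in> ideal_gen (mon ` A) \<longleftrightarrow> (\<exists>s\<in>A. s \<le> p)"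
proof
  assume "(mon p :: 'k poly2) \<in> ideal_gen (mon ` A)"
  then show "\<exists>s\<in>A. s \<le> p"
    by (rule keys_ideal_gen_monomials) simp
next
  assume "\<exists>s\<in>A. s \<le> p"
  then obtain s where "s \<in> A" "s \<le> p"
    by blast
  then obtain k where k: "(mon p :: 'k poly2) = k * mon s"
    using mon_dvd_iff[of s p, where 'k = 'k] by (metis dvdE mult.commute)
  show "(mon p :: 'k poly2) \<in> ideal_gen (mon ` A)"
    unfolding ideal_gen_def k using \<open>s \<in> A\<close>
    by (intro ring_module.span_scale ring_module.span_base) simp
qed

lemma ideal_gen_monomials_subset:
  assumes "\<And>p. p \<in> B \<Longrightarrow> \<exists>s\<in>A. s \<le> p"
  shows "ideal_gen (mon ` B) \<subseteq> (ideal_gen (mon ` A) :: 'k::comm_ring_1 poly2 set)"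
proof -
  have "mon ` B \<subseteq> (ideal_gen (mon ` A) :: 'k poly2 set)"
    using assms mon_in_ideal_gen_iff by blast
  then show ?thesis
    unfolding ideal_gen_def by (intro ring_module.span_minimal ring_module.subspace_span)
qed

text \<open>In any monomial generating set some \<open>q\<close> lies below a given
  \<open>p \<in> A\<close>, and some \<open>r \<in> A\<close> lies below \<open>q\<close>; the
  antichain property forces \<open>r = p\<close>, so \<open>q = p\<close>. Every such set thus
  contains the image of \<open>A\<close>, which yields both minimality and uniqueness.\<close>

lemma min_monomial_gens_antichain:
  assumes antichain: "\<And>p q. p \<in> A \<Longrightarrow> q \<in> A \<Longrightarrow> p \<le> q \<Longrightarrow> p = q"
  shows "min_monomial_gens (ideal_gen (mon ` A) :: 'k::comm_ring_1 poly2 set) = mon ` A"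
proof -
  let ?I = "ideal_gen (mon ` A) :: 'k poly2 set"
  have contained: "A \<subseteq> B" if "ideal_gen (mon ` B) = ?I" for B
  proof
    fix p assume p: "p \<in> A"
    have "(mon p :: 'k poly2) \<in> ideal_gen (mon ` B)"
      unfolding that using p mon_in_ideal_gen_iff by blast
    then obtain q where q: "q \<in> B" "q \<le> p"
      using mon_in_ideal_gen_iff by blast
    then have "(mon q :: 'k poly2) \<in> ?I"
      unfolding that[symmetric] mon_in_ideal_gen_iff by blast
    then obtain r where "r \<in> A" "r \<le> q"
      using mon_in_ideal_gen_iff by blast
    with p q antichain[of r p] show "p \<in> B"
      by (metis order.trans order.antisym)
  qed
  have contained': "mon ` A \<subseteq> H" if "H \<subseteq> monomials" "ideal_gen H = ?I" for H
  proof -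
    obtain B where "H = mon ` B"
      using \<open>H \<subseteq> monomials\<close> by (auto simp: monomials_eq subset_image_iff)
    then show ?thesis
      using contained[of B] that(2) by blast
  qed
  have A: "mon ` A \<subseteq> (monomials :: 'k poly2 set)"
    by (auto simp: monomials_eq)
  have "is_min_monomial_gens ?I (mon ` A)"
    unfolding is_min_monomial_gens_def
  proof (intro conjI allI impI notI)
    fix H :: "'k poly2 set" assume H: "H \<subset> mon ` A" "ideal_gen H = ?I"
    with A have "H \<subseteq> monomials"
      by (meson psubset_imp_subset subset_trans)
    from contained'[OF this H(2)] H(1) show False
      by (meson leD)
  qed (simp_all add: A)
  moreover have "G = mon ` A" if "is_min_monomial_gens ?I G" for G
    using that contained'[of G] unfolding is_min_monomial_gens_def by (metis psubsetI)
  ultimately show ?thesis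
    unfolding min_monomial_gens_def by (rule the_equality)
qed

text \<open>For entries at different positions, the first coordinates exclude one direction of
  \<open>\<le>\<close> and the second coordinates the other.\<close>

lemma antichain_if_sorted_wrt:
  fixes xs :: "(nat \<times> nat) list"
  assumes "sorted_wrt (\<lambda>p q. fst q < fst p \<and> snd p < snd q) xs"
    and "p \<in> set xs" "q \<in> set xs" "p \<le> q"
  shows "p = q"
  using assms by (induction xs) (auto simp: less_eq_prod_def)

text \<open>Bilinearity, in two inductions: first on the left factor with a generator on the right,
  then on the right factor with an arbitrary left one.\<close>

lemma ideal_square_ideal_gen:
  "ideal_square (ideal_gen S) = ideal_gen {s * t | s t. s \<in> S \<and> t \<in> S}"
proof -
  let ?T = "{s * t | s t. s \<in> S \<and> t \<in> S}"
  have left: "f * t \<in> ring_module.span ?T" if "f \<in> ring_module.span S" "t \<in> S" for f t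
    using that(1)
  proof (induction rule: ring_module.span_induct_alt)
    case base
    show ?case
      by (simp add: ring_module.span_zero)
  next
    case (step c s g)
    then have "s * t \<in> ring_module.span ?T"
      using that(2) by (intro ring_module.span_base) blast
    then have "c * (s * t) + g * t \<in> ring_module.span ?T"
      by (intro ring_module.span_add[OF ring_module.span_scale step(2)])
    then show ?case
      by (simp only: distrib_right mult.assoc)
  qed
  have "f * g \<in> ring_module.span ?T"
    if f: "f \<in> ring_module.span S" and "g \<in> ring_module.span S" for f g
    using that(2)
  proof (induction rule: ring_module.span_induct_alt)
    case base
    show ?case
      by (simp add: ring_module.span_zero)
  next
    case (step c t g)
    from step(1) have "c * (f * t) + f * g \<in> ring_module.span ?T"
      by (intro ring_module.span_add[OF ring_module.span_scale step(2)] left[OF f])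
    then show ?case
      by (simp only: distrib_left mult.left_commute)
  qed
  then have "ideal_square (ideal_gen S) \<subseteq> ideal_gen ?T"
    unfolding ideal_square_def ideal_gen_def
    by (intro ring_module.span_minimal ring_module.subspace_span) blast
  moreover have "ideal_gen ?T \<subseteq> ideal_square (ideal_gen S)"
    unfolding ideal_square_def ideal_gen_def
    by (intro ring_module.span_mono) (blast intro: ring_module.span_base)
  ultimately show ?thesis
    by blast
qed

theorem theorem3p4:
  fixes m :: nat
    and a b :: "nat \<Rightarrow> nat"
    and u :: "nat \<Rightarrow> 'k::field poly2"
    and I :: "'k poly2 set"
  assumes "m \<ge> 5"
    and "\<And>i. i \<in> {1..m} \<Longrightarrow> u i = var_x ^ a i * var_y ^ b i"
    and "strict_antimono_on {1..m} a"
    and "strict_mono_on {1..m} b"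
    and "I = ideal_gen (u ` {1..m})"
    and "u 1 * u m dvd u 2 * u (m - 1)"
    and "(u 2)\<^sup>2 dvd u 1 * u 3"
    and "(u (m - 1))\<^sup>2 dvd u (m - 2) * u m"
    and "(u 2)\<^sup>2 dvd u 1 * u (m - 2)"
    and "(u (m - 1))\<^sup>2 dvd u 3 * u m"
  shows "min_monomial_gens (ideal_square I) =
    {(u 1)\<^sup>2, u 1 * u 2, (u 2)\<^sup>2}
      \<union> {u 1 * u (m - 1), u 1 * u m, u 2 * u m}
      \<union> {(u (m - 1))\<^sup>2, u (m - 1) * u m, (u m)\<^sup>2}"
proof -
  define e where "e i = (a i, b i)" for i
  have u: "u i = mon (e i)" if "i \<in> {1..m}" for i
    using assms(2)[OF that] by (simp add: e_def monomial_eq_single)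
  have e_add: "e i + e j = (a i + a j, b i + b j)" for i j
    by (simp add: e_def)
  have uu: "u i * u j = mon (e i + e j)" if "i \<in> {1..m}" "j \<in> {1..m}" for i j
    using that by (simp add: u mon_mult)
  have dvd: "a i + a j \<le> a k + a l \<and> b i + b j \<le> b k + b l"
    if "u i * u j dvd u k * u l" "i \<in> {1..m}" "j \<in> {1..m}" "k \<in> {1..m}" "l \<in> {1..m}" for i j k l
    using that by (simp add: uu mon_dvd_iff e_add)
  have ineqs:
    "a 1 + a m \<le> a 2 + a (m - 1) \<and> b 1 + b m \<le> b 2 + b (m - 1)"
    "a 2 + a 2 \<le> a 1 + a 3 \<and> b 2 + b 2 \<le> b 1 + b 3"
    "a (m - 1) + a (m - 1) \<le> a (m - 2) + a m \<and> b (m - 1) + b (m - 1) \<le> b (m - 2) + b m"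
    "a 2 + a 2 \<le> a 1 + a (m - 2) \<and> b 2 + b 2 \<le> b 1 + b (m - 2)"
    "a (m - 1) + a (m - 1) \<le> a 3 + a m \<and> b (m - 1) + b (m - 1) \<le> b 3 + b m"
    using assms(6-10)[unfolded power2_eq_square, THEN dvd] assms(1) by simp_all
  have a_less: "a j < a i" and b_less: "b i < b j" if "1 \<le> i" "i < j" "j \<le> m" for i j
    using that monotone_onD[OF assms(3), of i j] monotone_onD[OF assms(4), of i j] by auto
  have a_le: "a j \<le> a i" and b_le: "b i \<le> b j" if "1 \<le> i" "i \<le> j" "j \<le> m" for i j
    using that a_less[of i j] b_less[of i j] by (cases "i = j"; simp)+
  \<comment> \<open>The inequalities between indices \<open>3\<close> and \<open>m - 2\<close> are
    weak because these coincide for \<open>m = 5\<close>.\<close>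
  have order:
    "a 2 < a 1" "a 3 < a 2" "a (m - 2) \<le> a 3" "a (m - 1) < a (m - 2)" "a m < a (m - 1)"
    "b 1 < b 2" "b 2 < b 3" "b 3 \<le> b (m - 2)" "b (m - 2) < b (m - 1)" "b (m - 1) < b m"
    using assms(1) by (auto intro: a_less b_less a_le b_le)

  define N where "N = {e 1 + e 1, e 1 + e 2, e 2 + e 2, e 1 + e (m - 1), e 1 + e m, e 2 + e m,
    e (m - 1) + e (m - 1), e (m - 1) + e m, e m + e m}"
  define P where "P = {e i + e j | i j. i \<in> {1..m} \<and> j \<in> {1..m}}"

  have N_P: "N \<subseteq> P"
  proof -
    have "{1, 2, m - 1, m} \<subseteq> {1..m}"
      using assms(1) by auto
    then show ?thesis
      unfolding N_def P_def by blast
  qed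
  have P_N: "\<exists>s\<in>N. s \<le> p" if "p \<in> P" for p
  proof -
    have below: "\<exists>s\<in>N. s \<le> e i + e j"
      if ij: "1 \<le> i" "i \<le> j" "j \<le> m" for i j
    proof -
      have mid: "a (m - 2) \<le> a k \<and> a k \<le> a 3 \<and> b 3 \<le> b k \<and> b k \<le> b (m - 2)"
        if "3 \<le> k" "k \<le> m - 2" for k
        using that assms(1) by (auto intro: a_le b_le)
      have split: "k = 1 \<or> k = 2 \<or> (3 \<le> k \<and> k \<le> m - 2) \<or> k = m - 1 \<or> k = m"
        if "1 \<le> k" "k \<le> m" for k
        using that by linarith
      have split_j: "j = 1 \<or> j = 2 \<or> (3 \<le> j \<and> j \<le> m - 2) \<or> j = m - 1 \<or> j = m"
        using split[of j] ij by linarith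
      consider "i = 1" | "i = 2" | "3 \<le> i" "i \<le> m - 2" | "i = m - 1" | "i = m"
        using split[of i] ij by linarith
      then show ?thesis
      proof cases
        case 1
        \<comment> \<open>Among middle indices \<open>a\<close> is least at \<open>m - 2\<close> and
          \<open>b\<close> at \<open>3\<close>, so the hypotheses on \<open>u 1 * u (m - 2)\<close>
          and \<open>u 1 * u 3\<close> bound one coordinate each.\<close>
        have "e 2 + e 2 \<le> e i + e j" if "3 \<le> j" "j \<le> m - 2"
          using mid[OF that] ineqs order 1 by (simp add: e_add)
        then show ?thesis
          using split_j 1 unfolding N_def by blast
      next
        case 2
        \<comment> \<open>By
          \<open>a 1 - a 2 \<le> a (m - 1) - a m \<le> a (m - 2) - a (m - 1)\<close> and
          \<open>b (m - 1) - b 3 \<le> b m - b (m - 1) \<le> b 2 - b 1\<close>.\<close>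
        have "e 1 + e (m - 1) \<le> e i + e j" if "3 \<le> j" "j \<le> m - 2"
          using mid[OF that] ineqs order 2 by (simp add: e_add)
        moreover have "e 1 + e m \<le> e i + e j" if "j = m - 1"
          using ineqs 2 that by (simp add: e_add)
        moreover have "j \<noteq> 1"
          using ij 2 by linarith
        ultimately show ?thesis
          using split_j 2 unfolding N_def by blast
      next
        case 3
        \<comment> \<open>The bound passes through \<open>e 2 + e (m - 1)\<close>, using
          \<open>a 2 - a (m - 2) \<le> a (m - 2) - a (m - 1)\<close> and
          \<open>b (m - 1) - b 3 \<le> b 3 - b 2\<close>.\<close>
        have "e 1 + e m \<le> e i + e j" if "3 \<le> j" "j \<le> m - 2"
          using mid[OF 3] mid[OF that] ineqs order by (simp add: e_add)
        \<comment> \<open>This bound and the next mirror the cases \<open>i = 2\<close> and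
          \<open>i = 1\<close> under reversing the indices and exchanging \<open>x\<close> and
          \<open>y\<close>.\<close>
        moreover have "e 2 + e m \<le> e i + e j" if "j = m - 1"
          using mid[OF 3] ineqs order that by (simp add: e_add)
        moreover have "e (m - 1) + e (m - 1) \<le> e i + e j" if "j = m"
          using mid[OF 3] ineqs order that by (simp add: e_add)
        moreover have "j \<noteq> 1" "j \<noteq> 2"
          using ij 3 by linarith+
        ultimately show ?thesis
          using split_j unfolding N_def by blast
      next
        case 4
        then have "j = m - 1 \<or> j = m"
          using ij by linarith
        then show ?thesis
          using 4 unfolding N_def by blast
      next
        case 5
        then have "j = m"
          using ij by linarith
        then show ?thesis
          using 5 unfolding N_def by blast
      qed
    qed
    obtain i j where ij: "i \<in> {1..m}" "j \<in> {1..m}" "p = e i + e j"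
      using \<open>p \<in> P\<close> unfolding P_def by blast
    then show ?thesis
      using below[of i j] below[of j i] by (cases "i \<le> j") (auto simp: add.commute)
  qed
  let ?r = "\<lambda>p q :: nat \<times> nat. fst q < fst p \<and> snd p < snd q"
  \<comment> \<open>Transitivity reduces sortedness to neighbours. Only the steps from
    \<open>e 2 + e 2\<close> to \<open>e 1 + e (m - 1)\<close> and from \<open>e 2 + e m\<close> to
    \<open>e (m - 1) + e (m - 1)\<close> go beyond the monotonicity of \<open>a\<close> and
    \<open>b\<close>.\<close>
  have "transp ?r"
    by (auto intro: transpI)
  then have "sorted_wrt ?r [e 1 + e 1, e 1 + e 2, e 2 + e 2, e 1 + e (m - 1), e 1 + e m, e 2 + e m,
    e (m - 1) + e (m - 1), e (m - 1) + e m, e m + e m]" (is "sorted_wrt _ ?xs")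
    using ineqs order by (simp add: sorted_wrt1 sorted_wrt2 e_add del: sorted_wrt.simps(2))
  moreover have "N = set ?xs"
    by (simp add: N_def)
  ultimately have antichain: "p = q" if "p \<in> N" "q \<in> N" "p \<le> q" for p q
    using that antichain_if_sorted_wrt by blast

  have "{s * t | s t. s \<in> u ` {1..m} \<and> t \<in> u ` {1..m}} = {u i * u j | i j. i \<in> {1..m} \<and> j \<in> {1..m}}"
    by blast
  also have "\<dots> = {mon (e i + e j) | i j. i \<in> {1..m} \<and> j \<in> {1..m}}"
    by (intro Collect_cong) (metis uu)
  also have "\<dots> = mon ` P"
    unfolding P_def by blast
  finally have "ideal_square I = ideal_gen (mon ` P)"
    by (simp add: assms(5) ideal_square_ideal_gen)
  also have "\<dots> = ideal_gen (mon ` N)"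
    using P_N N_P by (intro equalityI ideal_gen_monomials_subset) auto
  finally have "min_monomial_gens (ideal_square I) = mon ` N"
    using min_monomial_gens_antichain[of N, OF antichain] by simp
  also have "mon ` N = {u 1 * u 1, u 1 * u 2, u 2 * u 2}
      \<union> {u 1 * u (m - 1), u 1 * u m, u 2 * u m}
      \<union> {u (m - 1) * u (m - 1), u (m - 1) * u m, u m * u m}"
    using assms(1) by (simp add: N_def uu insert_commute)
  finally show ?thesis
    by (simp only: power2_eq_square)
qed

end
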